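(* Let $\mathbf{u}$ be a Parry word (simple or non-simple), i.e. the fixed point of a Parry substitution $\varphi$, let $U_j=|\varphi^j(0)|$ for $j\ge0$, and assume $\mathbf{u}$ is $c$-balanced for some $c>0$. Then there exist a finite set of states $Q$, an initial state $q_0\in Q$ and a transition function $\delta:Q\times\{0,1,\dots,\alpha_0\}\to Q$ such that for every function $F:\mathbb{N}\to\mathbb{N}$ that is defined in terms of the set of relative Parikh vectors $\mathcal{P}^{\mathrm{rel}}_{\mathbf{u}}(n)$ (i.e. $F(n)=G(\mathcal{P}^{\mathrm{rel}}_{\mathbf{u}}(n))$ for all $n\in\mathbb{N}$, for some map $G$ from $\{\mathcal{P}^{\mathrm{rel}}_{\mathbf{u}}(n):n\in\mathbb{N}\}$ to $\mathbb{N}$) there is an output function $\tau:Q\to\mathbb{N}$ with $$F(n)=\tau(\delta(q_0,\langle n\rangle_U))\qquad\text{for all } n\in\mathbb{N}.$$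
   Context: $\mathbb{N}=\{1,2,3,\dots\}$. For a finite word $w$, $|w|$ is its length and $|w|_\ell$ the number of occurrences of the letter $\ell$ in $w$. Parry words. A simple Parry word over $\mathcal{A}=\{0,1,\dots,m-1\}$ ($m\ge 2$) is the fixed point $\mathbf{u}=u_0u_1u_2\cdots$ of the substitution $\varphi(\ell)=0^{\alpha_\ell}(\ell+1)$ for $0\le \ell\le m-2$, $\varphi(m-1)=0^{\alpha_{m-1}}$. A non-simple Parry word over $\mathcal{A}=\{0,1,\dots,m+p-1\}$ ($m,p\ge1$) is the fixed point $\mathbf{u}=u_0u_1u_2\cdots$ of $\varphi(\ell)=0^{\alpha_\ell}(\ell+1)$ for $0\le\ell\le m+p-2$, $\varphi(m+p-1)=0^{\alpha_{m+p-1}}m$. The $\alpha_\ell$ are non-negative integers with $\alpha_0\ge1$ and $\alpha_\ell\le\alpha_0$ for all $\ell\in\mathcal{A}$; in the simple case $\alpha_{m-1}\ge1$; in the non-simple case $\alpha_\ell\ge1$ for some $\ell\in\{m,\dots,m+p-1\}$. Moreover they satisfy Parry's condition: putting $t=\alpha_0\cdots\alpha_{m-1}0^\omega$ (simple case) or $t=\alpha_0\cdots\alpha_{m-1}(\alpha_m\cdots\alpha_{m+p-1})^\omega$ (non-simple case), every shift $t_it_{i+1}\cdots$ with $i\ge1$ is strictly lexicographically smaller than $t=t_0t_1\cdots$. Normal $U$-representation. For $n\in\mathbb{N}$, $\langle n\rangle_U=d_kd_{k-1}\cdots d_0$ is the word of digits of the expansion $n=\sum_{j=0}^k d_jU_j$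 obtained by the greedy algorithm ($U_k\le n<U_{k+1}$, so $d_k\neq0$); all digits lie in $\{0,1,\dots,\alpha_0\}$. $c$-balanced: $\bigl||v|_\ell-|w|_\ell\bigr|\le c$ for every $\ell\in\mathcal{A}$ and all factors $v,w$ of $\mathbf{u}$ with $|v|=|w|$. Relative Parikh vectors. $\Psi(w)=(|w|_\ell)_{\ell\in\mathcal{A}}$; for a factor $w$ of $\mathbf{u}$ of length $n$, $\Psi^{\mathrm{rel}}_{\mathbf{u}}(w)=\Psi(w)-\Psi(u_0u_1\cdots u_{n-1})$; and $\mathcal{P}^{\mathrm{rel}}_{\mathbf{u}}(n)=\{\Psi^{\mathrm{rel}}_{\mathbf{u}}(w): w\text{ a factor of }\mathbf{u},\ |w|=n\}$. The transition function is extended to words by $\delta(q,\epsilon)=q$, $\delta(q,xa)=\delta(\delta(q,x),a)$ (words are read from the most significant digit). *)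

theory Defs
  imports Main "HOL-Library.Omega_Words_Fun" "HOL-Library.Fun_Lexorder" "HOL-Library.FuncSet"
begin

text \<open>Letters are natural numbers, the alphabet with \<open>N\<close> letters is \<open>{..<N}\<close>.\<close>

type_synonym substitution = "nat \<Rightarrow> nat list"

definition apply_subst :: "substitution \<Rightarrow> nat list \<Rightarrow> nat list" where
  "apply_subst \<phi> w = concat (map \<phi> w)"

definition simple_subst :: "nat \<Rightarrow> (nat \<Rightarrow> nat) \<Rightarrow> substitution" where
  "simple_subst m \<alpha> l = replicate (\<alpha> l) 0 @ (if l + 1 < m then [l + 1] else [])"

definition nonsimple_subst :: "nat \<Rightarrow> nat \<Rightarrow> (nat \<Rightarrow> nat) \<Rightarrow> substitution" where
  "nonsimple_subst m p \<alpha> l = replicate (\<alpha> l) 0 @ (if l + 1 < m + p then [l + 1] else [m])"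

definition parry_condition :: "nat word \<Rightarrow> bool" where
  "parry_condition t \<longleftrightarrow> (\<forall>i\<ge>1. less_fun (suffix i t) t)"

definition simple_parry_params :: "nat \<Rightarrow> (nat \<Rightarrow> nat) \<Rightarrow> bool" where
  "simple_parry_params m \<alpha> \<longleftrightarrow>
     m \<ge> 2 \<and> \<alpha> 0 \<ge> 1 \<and> (\<forall>l<m. \<alpha> l \<le> \<alpha> 0) \<and> \<alpha> (m - 1) \<ge> 1 \<and>
     parry_condition (map \<alpha> [0..<m] \<frown> [0]\<^sup>\<omega>)"

definition nonsimple_parry_params :: "nat \<Rightarrow> nat \<Rightarrow> (nat \<Rightarrow> nat) \<Rightarrow> bool" where
  "nonsimple_parry_params m p \<alpha> \<longleftrightarrow>
     m \<ge> 1 \<and> p \<ge> 1 \<and> \<alpha> 0 \<ge> 1 \<and> (\<forall>l<m + p. \<alpha> l \<le> \<alpha> 0) \<and> (\<exists>l\<in>{m..<m + p}. \<alpha> l \<ge> 1) \<and>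
     parry_condition (map \<alpha> [0..<m] \<frown> (map \<alpha> [m..<m + p])\<^sup>\<omega>)"

text \<open>Only the values \<open>\<alpha> l\<close> with \<open>l < N\<close> are relevant.\<close>

definition parry_substitution :: "nat \<Rightarrow> (nat \<Rightarrow> nat) \<Rightarrow> substitution \<Rightarrow> bool" where
  "parry_substitution N \<alpha> \<phi> \<longleftrightarrow>
     (\<exists>m. simple_parry_params m \<alpha> \<and> N = m \<and> \<phi> = simple_subst m \<alpha>) \<or>
     (\<exists>m p. nonsimple_parry_params m p \<alpha> \<and> N = m + p \<and> \<phi> = nonsimple_subst m p \<alpha>)"

text \<open>
  For a non-erasing \<open>\<phi>\<close>, the infinite words \<open>\<phi>(u)\<close> and \<open>u\<close> coincide iff the image of every
  prefix of \<open>u\<close> is a prefix of \<open>u\<close>.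
\<close>

definition is_fixed_point :: "nat \<Rightarrow> substitution \<Rightarrow> nat word \<Rightarrow> bool" where
  "is_fixed_point N \<phi> u \<longleftrightarrow>
     (\<forall>i. u i < N) \<and>
     (\<forall>n. apply_subst \<phi> (prefix n u) = prefix (length (apply_subst \<phi> (prefix n u))) u)"

definition is_factor :: "nat list \<Rightarrow> nat word \<Rightarrow> bool" where
  "is_factor w u \<longleftrightarrow> (\<exists>i. w = u [i \<rightarrow> i + length w])"

definition balanced :: "nat \<Rightarrow> nat \<Rightarrow> nat word \<Rightarrow> bool" where
  "balanced N c u \<longleftrightarrow>
     (\<forall>l<N. \<forall>v w. is_factor v u \<and> is_factor w u \<and> length v = length w \<longrightarrow>
        \<bar>int (count_list v l) - int (count_list w l)\<bar> \<le> int c)"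

text \<open>
  Vectors indexed by the alphabet are total functions; all entries at indices outside the
  alphabet are zero for words over the alphabet.
\<close>

definition parikh :: "nat list \<Rightarrow> nat \<Rightarrow> int" where
  "parikh w = (\<lambda>l. int (count_list w l))"

definition rel_parikh :: "nat word \<Rightarrow> nat list \<Rightarrow> nat \<Rightarrow> int" where
  "rel_parikh u w = (\<lambda>l. parikh w l - parikh (prefix (length w) u) l)"

definition rel_parikh_set :: "nat word \<Rightarrow> nat \<Rightarrow> (nat \<Rightarrow> int) set" where
  "rel_parikh_set u n = {rel_parikh u w | w. is_factor w u \<and> length w = n}"

definition U_seq :: "substitution \<Rightarrow> nat \<Rightarrow> nat" where
  "U_seq \<phi> j = length ((apply_subst \<phi> ^^ j) [0])"

text \<open>Greedy digits of \<open>n\<close> at the positions \<open>k, \<dots>, 0\<close>, most significant digit first.\<close>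

primrec greedy_digits :: "(nat \<Rightarrow> nat) \<Rightarrow> nat \<Rightarrow> nat \<Rightarrow> nat list" where
  "greedy_digits U 0 n = [n div U 0]"
| "greedy_digits U (Suc k) n = (n div U (Suc k)) # greedy_digits U k (n mod U (Suc k))"

definition normal_rep :: "(nat \<Rightarrow> nat) \<Rightarrow> nat \<Rightarrow> nat list" where
  "normal_rep U n = greedy_digits U (THE k. U k \<le> n \<and> n < U (Suc k)) n"

end

theory Submission
  imports Defs
begin

text \<open>
  Call an index of \<open>u\<close> a cut; a factor is a pair of cuts. Every cut lies at some offset inside a
  block \<open>\<phi> (u j)\<close>, so it comes from the cut \<open>j\<close>, and Parikh vectors of prefixes transform linearly
  under \<open>\<phi>\<close>. If the prefix of length \<open>n'\<close> is the image of the prefix of length \<open>n\<close> followed by \<open>a\<close>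
  zeros, then the Parikh vector of a factor relative to the prefix of length \<open>n'\<close> is determined by
  that of the desubstituted factor relative to the prefix of length \<open>n\<close>, by the letters at the two
  cuts, by the offsets and by \<open>a\<close>.

  The desubstituted factors need not have length exactly \<open>n\<close>. The state of \<open>n\<close> therefore collects the
  relative vectors, with the letters at both ends, of all pairs of cuts whose signed distance differs from
  \<open>n\<close> by at most a constant \<open>window\<close>. Such a family is closed under desubstitution because \<open>\<phi>\<close> lengthens
  long factors by more than any prescribed amount, whereas balance makes the lengths of images
  of equally long factors differ by a bounded amount only (\<open>window_pullback\<close>). Hence the next state is
  a function of the state and of \<open>a\<close> (\<open>state_img\<close>). Balance also bounds the entries of all vectors in
  a state, so there are finitely many states (\<open>finite_range_state\<close>), and the relative Parikh vectors of
  \<open>n\<close> are the vectors of coordinate sum 0 in the state of \<open>n\<close>.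

  It remains to see that reading the normal representation of \<open>n\<close> performs steps of this kind and
  ends in the prefix of length \<open>n\<close> (\<open>foldl_normal_rep\<close>). Descending through the images of letters
  produces a digit string for \<open>n\<close>; it is the greedy one as soon as no letter
  has longer iterated images than 0 (\<open>L_le\<close>), and this is what the Parry condition yields.
\<close>

section \<open>Parry words through the orbit of the letter 0\<close>

lemma apply_subst_append [simp]:
  "apply_subst \<phi> (v @ w) = apply_subst \<phi> v @ apply_subst \<phi> w"
  by (simp add: apply_subst_def)

lemma apply_subst_Nil [simp]: "apply_subst \<phi> [] = []"
  by (simp add: apply_subst_def)

lemma apply_subst_singleton [simp]: "apply_subst \<phi> [l] = \<phi> l"
  by (simp add: apply_subst_def)

lemma apply_subst_pow_Nil [simp]: "(apply_subst \<phi> ^^ k) [] = []"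
  by (induction k) auto

lemma apply_subst_pow_append [simp]:
  "(apply_subst \<phi> ^^ k) (v @ w) = (apply_subst \<phi> ^^ k) v @ (apply_subst \<phi> ^^ k) w"
  by (induction k) auto

lemma apply_subst_pow_replicate:
  "length ((apply_subst \<phi> ^^ k) (replicate a l)) = a * length ((apply_subst \<phi> ^^ k) [l])"
proof (induction a)
  case (Suc a)
  have "replicate (Suc a) l = [l] @ replicate a l"
    by simp
  then show ?case
    using Suc by (simp only: apply_subst_pow_append length_append) simp
qed simp

lemma parikh_append: "parikh (v @ w) l = parikh v l + parikh w l"
  by (simp add: parikh_def)

text \<open>
  The simple and the non-simple case are treated together by following the last letter of the
  iterated images of 0: \<open>orb i\<close> is the last letter of \<open>\<phi>\<^sup>i(0)\<close> as a word of length one, or the empty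
  word once the orbit of a simple substitution has ended, and \<open>t\<close> is the infinite word of the Parry condition. The
  last assumption says that the orbit is alive exactly as long as a nonzero digit is still to come;
  this excludes erased letters and makes 0 recur.
\<close>
locale parry_word =
  fixes N :: nat and \<phi> :: substitution and u :: "nat word"
    and orb :: "nat \<Rightarrow> nat list" and t :: "nat word"
  assumes two_letters: "2 \<le> N"
    and fixed_point: "is_fixed_point N \<phi> u"
    and parry: "parry_condition t"
    and t0_pos: "0 < t 0"
    and orb_letter: "l < N \<Longrightarrow> orb l = [l]"
    and orb_subst: "apply_subst \<phi> (orb i) = replicate (t i) 0 @ orb (Suc i)"
    and orb_length: "length (orb i) \<le> 1"
    and orb_alive: "orb i \<noteq> [] \<longleftrightarrow> (\<exists>k\<ge>i. 0 < t k)"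
begin

lemma letter: "u i < N"
  using fixed_point by (simp add: is_fixed_point_def)

lemma subst_letter: "l < N \<Longrightarrow> \<phi> l = replicate (t l) 0 @ orb (Suc l)"
  using orb_subst[of l] by (simp add: orb_letter)

lemma subst_nonempty:
  assumes "l < N"
  shows "0 < length (\<phi> l)"
proof (cases "t l = 0")
  case True
  have "orb l \<noteq> []"
    using assms by (simp add: orb_letter)
  then obtain k where k: "k \<ge> l" "0 < t k"
    using orb_alive by blast
  with True have "Suc l \<le> k"
    by (metis Suc_leI le_neq_implies_less less_irrefl)
  then show ?thesis
    using k assms orb_alive[of "Suc l"] by (auto simp: subst_letter)
qed (use assms in \<open>simp add: subst_letter\<close>)

lemma t_le: "t i \<le> t 0"
proof (cases "i = 0")
  case False
  then have "less_fun (suffix i t) t"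
    using parry by (simp add: parry_condition_def)
  then obtain k where "suffix i t k < t k" "\<And>j. j < k \<Longrightarrow> suffix i t j = t j"
    by (rule less_funE) blast
  then show ?thesis
    by (cases k) (auto simp: less_imp_le dest: spec[of _ 0] meta_spec[of _ 0])
qed simp

lemma subst_length_le: "l < N \<Longrightarrow> length (\<phi> l) \<le> t 0 + 1"
  using t_le[of l] orb_length[of "Suc l"] by (simp add: subst_letter)

lemma orb_1: "orb 1 = [1]"
  using two_letters orb_letter[of 1] by simp

lemma orb_0: "orb 0 = [0]"
  using two_letters orb_letter[of 0] by simp

lemma subst_zero_length: "2 \<le> length (\<phi> 0)"
  using two_letters t0_pos by (simp add: subst_letter orb_1[simplified])

text \<open>
  A letter without zeros in its image is replaced by its successor in the orbit; a first letter
  different from 0 would therefore be its own successor, and the orbit would never produce a zero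
  again.
\<close>
lemma u_0: "u 0 = 0"
proof (rule ccontr)
  define l where "l = u 0"
  assume "u 0 \<noteq> 0"
  then have l: "l < N" "l \<noteq> 0"
    by (auto simp: l_def letter)
  have ne: "\<phi> l \<noteq> []"
    using subst_nonempty[OF l(1)] by auto
  have "apply_subst \<phi> (prefix 1 u) = prefix (length (apply_subst \<phi> (prefix 1 u))) u"
    using fixed_point unfolding is_fixed_point_def by blast
  moreover have "prefix 1 u = [l]"
    by (simp add: subsequence_def l_def)
  ultimately have "\<phi> l = prefix (length (\<phi> l)) u"
    by simp
  then have "hd (\<phi> l) = l"
    using ne by (metis length_greater_0_conv minus_nat.diff_0 subsequence_nth add_0 hd_conv_nth l_def)
  moreover have t: "t l = 0"
    using calculation l(2) by (cases "t l") (auto simp: subst_letter[OF l(1)])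
  moreover obtain x where "orb (Suc l) = [x]"
    using ne orb_length[of "Suc l"] t by (cases "orb (Suc l)") (auto simp: subst_letter[OF l(1)])
  ultimately have base: "orb (Suc l) = [l]"
    by (simp add: subst_letter[OF l(1)])
  have step: "t j = 0 \<and> orb (Suc j) = [l]" if "l \<le> j" for j
    using that
  proof (induction j rule: dec_induct)
    case (step j)
    then have "\<phi> l = replicate (t (Suc j)) 0 @ orb (Suc (Suc j))"
      using orb_subst[of "Suc j"] by simp
    moreover have "\<phi> l = [l]"
      using subst_letter[OF l(1)] base t by simp
    ultimately show ?case
      using l(2) by (cases "t (Suc j)") auto
  qed (use base t in simp)
  have "orb l \<noteq> []"
    using l(1) by (simp add: orb_letter)
  then obtain k where "k \<ge> l" "0 < t k"
    using orb_alive by blast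
  then show False
    using step[of k] by simp
qed

section \<open>Greedy digits and prefixes\<close>

text \<open>
  \<open>L k 0\<close> is \<open>U\<^sub>k\<close>; the other columns are needed because the descent for greedy digits passes
  through the images of all letters of the orbit.
\<close>
abbreviation L :: "nat \<Rightarrow> nat \<Rightarrow> nat" where
  "L k i \<equiv> length ((apply_subst \<phi> ^^ k) (orb i))"

lemma U_seq_eq: "U_seq \<phi> k = L k 0"
  by (simp add: U_seq_def orb_0)

lemma L_Suc: "L (Suc k) i = t i * L k 0 + L k (Suc i)"
  by (simp only: funpow_Suc_right o_apply orb_subst apply_subst_pow_append length_append
      apply_subst_pow_replicate orb_0)

text \<open>
  The Parry condition makes the images of 0 the longest ones. The comparison has to be proved for
  two arbitrary positions of the orbit, since stripping a common first digit compares the two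
  successors; at a strict first digit the condition itself bounds the remainder by a further
  copy of the image of 0.
\<close>
lemma L_mono_lex:
  assumes "suffix i t = suffix j t \<or> less_fun (suffix i t) (suffix j t)"
  shows "L k i \<le> L k j"
  using assms
proof (induction k arbitrary: i j)
  case 0
  show ?case
  proof (cases "orb i = []")
    case False
    then obtain k where k: "k \<ge> i" "0 < t k"
      using orb_alive by blast
    have "orb j \<noteq> []"
    proof
      assume "orb j = []"
      then have z: "t (j + x) = 0" for x
        using orb_alive[of j] by auto
      then have "\<not> less_fun (suffix i t) (suffix j t)"
        by (auto simp: less_fun_def)
      then have "suffix i t (k - i) = suffix j t (k - i)"
        using 0 by metis
      then show False
        using k z[of "k - i"] by simp
    qed
    then show ?thesis
      using orb_length[of i] by (cases "orb j") auto
  qed simp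
next
  case (Suc k)
  have top: "L k (Suc i) \<le> L k 0"
  proof (rule Suc.IH)
    have "less_fun (suffix (Suc i) t) t"
      using parry by (simp add: parry_condition_def)
    then show "suffix (Suc i) t = suffix 0 t \<or> less_fun (suffix (Suc i) t) (suffix 0 t)"
      by (simp add: suffix_def)
  qed
  consider "t i < t j" | "t i = t j"
    "suffix (Suc i) t = suffix (Suc j) t \<or> less_fun (suffix (Suc i) t) (suffix (Suc j) t)"
  proof -
    have "(t i < t j) \<or> (t i = t j \<and> (suffix (Suc i) t = suffix (Suc j) t \<or>
        less_fun (suffix (Suc i) t) (suffix (Suc j) t)))"
      using Suc.prems
    proof
      assume "suffix i t = suffix j t"
      then have eq: "t (i + x) = t (j + x)" for x
        by (metis suffix_nth)
      have "suffix (Suc i) t = suffix (Suc j) t"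
        using eq[of "Suc _"] by (simp add: fun_eq_iff)
      then show ?thesis
        using eq[of 0] by simp
    next
      assume "less_fun (suffix i t) (suffix j t)"
      then obtain s where s: "suffix i t s < suffix j t s"
        "\<And>x. x < s \<Longrightarrow> suffix i t x = suffix j t x"
        by (rule less_funE) blast
      show ?thesis
      proof (cases s)
        case 0
        then show ?thesis using s by simp
      next
        case (Suc s')
        have "less_fun (suffix (Suc i) t) (suffix (Suc j) t)"
          unfolding less_fun_def
          using s(1) s(2)[of "Suc _"] Suc by (intro exI[of _ s']) simp
        then show ?thesis
          using s(2)[of 0] Suc by simp
      qed
    qed
    then show ?thesis using that by blast
  qed
  then show ?case
  proof cases
    case 1
    have "L (Suc k) i \<le> t i * L k 0 + L k 0"
      using top by (simp only: L_Suc)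
    also have "\<dots> = (t i + 1) * L k 0"
      by simp
    also have "\<dots> \<le> t j * L k 0"
      using 1 by (intro mult_right_mono) auto
    also have "\<dots> \<le> L (Suc k) j"
      by (simp only: L_Suc)
    finally show ?thesis .
  next
    case 2
    then have "L k (Suc i) \<le> L k (Suc j)"
      by (intro Suc.IH)
    then show ?thesis
      using 2(1) by (simp only: L_Suc nat_add_left_cancel_le)
  qed
qed

lemma L_le: "L k i \<le> L k 0"
proof (rule L_mono_lex)
  show "suffix i t = suffix 0 t \<or> less_fun (suffix i t) (suffix 0 t)"
    using parry by (cases "i = 0") (auto simp: parry_condition_def suffix_def)
qed

lemma L_pos:
  assumes "orb i \<noteq> []"
  shows "0 < L k i"
  using assms
proof (induction k arbitrary: i)
  case (Suc k)
  show ?case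
  proof (cases "t i = 0")
    case True
    obtain s where "s \<ge> i" "0 < t s"
      using Suc.prems orb_alive by blast
    with True have "Suc i \<le> s"
      by (metis Suc_leI le_neq_implies_less less_irrefl)
    then have "orb (Suc i) \<noteq> []"
      using \<open>0 < t s\<close> orb_alive by blast
    then have "0 < L k (Suc i)"
      by (rule Suc.IH)
    then show ?thesis
      by (simp only: L_Suc)
  next
    case False
    moreover have "0 < L k 0"
      by (rule Suc.IH) (simp add: orb_0)
    ultimately have "0 < t i * L k 0"
      by simp
    then show ?thesis
      by (simp only: L_Suc)
  qed
qed simp

lemma U_Suc_greater: "U_seq \<phi> k < U_seq \<phi> (Suc k)"
proof -
  have "L k 0 \<le> t 0 * L k 0"
    using t0_pos by simp
  moreover have "0 < L k (Suc 0)"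
    by (rule L_pos) (simp add: orb_1[simplified])
  ultimately have "L k 0 < t 0 * L k 0 + L k (Suc 0)"
    by linarith
  then show ?thesis
    by (simp only: U_seq_eq L_Suc)
qed

lemma U_0: "U_seq \<phi> 0 = 1"
  by (simp add: U_seq_def)

lemma U_strict_mono: "strict_mono (U_seq \<phi>)"
  by (simp add: strict_mono_Suc_iff U_Suc_greater)

lemma normal_rep_eq:
  assumes "1 \<le> n"
  obtains k where "n < U_seq \<phi> (Suc k)" "normal_rep (U_seq \<phi>) n = greedy_digits (U_seq \<phi>) k n"
proof -
  have ex: "\<exists>j. n < U_seq \<phi> j"
    using strict_mono_imp_increasing[OF U_strict_mono, of "Suc n"] by (intro exI[of _ "Suc n"]) linarith
  define j where "j = (LEAST j. n < U_seq \<phi> j)"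
  have j: "n < U_seq \<phi> j"
    unfolding j_def using ex by (rule LeastI_ex)
  then obtain k where k: "j = Suc k"
    using assms U_0 by (cases j) auto
  have less: "n < U_seq \<phi> (Suc k)"
    using j k by simp
  have "U_seq \<phi> k \<le> n"
    using not_less_Least[of k "\<lambda>j. n < U_seq \<phi> j"] k unfolding j_def by simp
  then have "(THE k. U_seq \<phi> k \<le> n \<and> n < U_seq \<phi> (Suc k)) = k"
  proof (intro the_equality conjI)
    fix k' assume k': "U_seq \<phi> k' \<le> n \<and> n < U_seq \<phi> (Suc k')"
    have "U_seq \<phi> k < U_seq \<phi> (Suc k')" "U_seq \<phi> k' < U_seq \<phi> (Suc k)"
      using k' \<open>U_seq \<phi> k \<le> n\<close> less by linarith+
    then show "k' = k"
      by (simp add: strict_mono_less[OF U_strict_mono])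
  qed (use less in simp_all)
  then show ?thesis
    using that[of k] less by (simp add: normal_rep_def)
qed

definition is_prefix :: "nat list \<Rightarrow> bool" where
  "is_prefix w \<longleftrightarrow> w = prefix (length w) u"

lemma is_prefix_prefix [simp]: "is_prefix (prefix n u)"
  by (simp add: is_prefix_def)

lemma is_prefix_append: "is_prefix (v @ w) \<Longrightarrow> is_prefix v"
  by (metis append_eq_conv_conj is_prefix_def subsequence_take add_0 length_append min_absorb1 le_add1)

lemma is_prefix_subst: "is_prefix w \<Longrightarrow> is_prefix (apply_subst \<phi> w)"
  using fixed_point unfolding is_prefix_def is_fixed_point_def by metis

text \<open>
  The greedy digits of \<open>r\<close> spell out, one digit at a time, the prefix that reaches \<open>r\<close> letters into
  the image of the orbit letter following \<open>w\<close>. If the leading digit is smaller than \<open>t i\<close>, the next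
  letter is a zero. Otherwise all \<open>t i\<close> zeros are consumed, and the rest lies in the image of the
  next orbit letter, which is at most as long as that of 0, so that the greedy algorithm does not
  take a larger digit. Here \<open>f\<close> labels prefix lengths and \<open>\<delta>\<close> follows the labels along the
  steps from \<open>w\<close> to \<open>\<phi>(w)0\<^sup>a\<close>.
\<close>
lemma foldl_greedy_digits:
  assumes step: "\<And>w a. \<lbrakk>is_prefix w; a \<le> t 0; is_prefix (apply_subst \<phi> w @ replicate a 0)\<rbrakk>
      \<Longrightarrow> \<delta> (f (length w)) a = f (length (apply_subst \<phi> w) + a)"
    and "is_prefix (w @ orb i)" "r < L (Suc k) i"
  shows "foldl \<delta> (f (length w)) (greedy_digits (U_seq \<phi>) k r)
    = f (length ((apply_subst \<phi> ^^ Suc k) w) + r)"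
  using assms(2,3)
proof (induction k arbitrary: w i r)
  case 0
  have pre: "is_prefix (apply_subst \<phi> w @ replicate (t i) 0 @ orb (Suc i))"
    using is_prefix_subst[OF 0(1)] by (simp add: orb_subst)
  have "r \<le> t i"
    using 0(2) orb_length[of "Suc i"] by (simp add: orb_subst)
  then have split: "replicate (t i) 0 = replicate r 0 @ replicate (t i - r) (0::nat)"
    by (metis le_add_diff_inverse replicate_add)
  have "is_prefix (apply_subst \<phi> w @ replicate r 0)"
    by (rule is_prefix_append[where w = "replicate (t i - r) 0 @ orb (Suc i)"])
      (use pre split in simp)
  then have "\<delta> (f (length w)) r = f (length (apply_subst \<phi> w) + r)"
    using \<open>r \<le> t i\<close> t_le[of i] is_prefix_append[OF 0(1)] by (intro step) auto
  then show ?case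
    by (simp add: U_0)
next
  case (Suc k)
  define m where "m = Suc k"
  define U where "U = L m 0"
  have U_pos: "0 < U"
    unfolding U_def by (rule L_pos) (simp add: orb_0)
  have pre: "is_prefix (apply_subst \<phi> w @ replicate (t i) 0 @ orb (Suc i))"
    using is_prefix_subst[OF Suc.prems(1)] by (simp add: orb_subst)
  have r: "r < t i * U + L m (Suc i)"
    using Suc.prems(2) unfolding U_def m_def by (simp only: L_Suc[of "Suc k"])
  define d where "d = r div U"
  have "\<exists>j. d \<le> t i \<and> is_prefix ((apply_subst \<phi> w @ replicate d 0) @ orb j) \<and> r mod U < L m j"
  proof (cases "r < t i * U")
    case True
    then have d: "d < t i"
      by (simp add: d_def less_mult_imp_div_less)
    then have "replicate (t i) 0 = replicate d 0 @ [0::nat] @ replicate (t i - d - 1) 0"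
      by (metis add_diff_inverse_nat less_imp_not_less replicate_Suc append_Cons append_Nil
          replicate_add Suc_diff_Suc diff_Suc_1' One_nat_def)
    then have "is_prefix (((apply_subst \<phi> w @ replicate d 0) @ orb 0)
        @ replicate (t i - d - 1) 0 @ orb (Suc i))"
      using pre by (simp add: orb_0)
    then have "is_prefix ((apply_subst \<phi> w @ replicate d 0) @ orb 0)"
      by (rule is_prefix_append)
    moreover have "r mod U < L m 0"
      using U_pos by (simp add: U_def[symmetric])
    ultimately show ?thesis
      using d less_imp_le by blast
  next
    case False
    define s where "s = r - t i * U"
    have s: "r = t i * U + s" "s < L m (Suc i)"
      using False r by (auto simp: s_def)
    have "s < U"
      using s(2) L_le[of m "Suc i"] by (simp add: U_def)
    then have "d = t i" "r mod U = s"
      by (simp_all add: d_def s(1))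
    then show ?thesis
      using pre s(2) by (intro exI[of _ "Suc i"]) simp
  qed
  then obtain j where d: "d \<le> t i" and pre': "is_prefix ((apply_subst \<phi> w @ replicate d 0) @ orb j)"
    and rem: "r mod U < L m j"
    by blast
  define w' where "w' = apply_subst \<phi> w @ replicate d 0"
  have "\<delta> (f (length w)) d = f (length (apply_subst \<phi> w) + d)"
    using d t_le[of i] is_prefix_append[OF Suc.prems(1)] is_prefix_append[OF pre']
    by (intro step) auto
  then have "\<delta> (f (length w)) d = f (length w')"
    by (simp add: w'_def)
  then have "foldl \<delta> (f (length w)) (greedy_digits (U_seq \<phi>) (Suc k) r)
      = foldl \<delta> (f (length w')) (greedy_digits (U_seq \<phi>) k (r mod U))"
    by (simp add: U_seq_eq[of "Suc k"] U_def m_def d_def)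
  also have "\<dots> = f (length ((apply_subst \<phi> ^^ m) w') + r mod U)"
    unfolding m_def using Suc.IH[of w' j "r mod U"] pre' rem by (simp only: w'_def m_def)
  also have "length ((apply_subst \<phi> ^^ m) w') = length ((apply_subst \<phi> ^^ Suc m) w) + d * U"
    unfolding w'_def U_def
    by (simp only: apply_subst_pow_append length_append apply_subst_pow_replicate orb_0
        funpow_Suc_right o_apply)
  finally show ?case
    by (simp add: d_def m_def add.assoc)
qed

lemma foldl_normal_rep:
  assumes step: "\<And>w a. \<lbrakk>is_prefix w; a \<le> t 0; is_prefix (apply_subst \<phi> w @ replicate a 0)\<rbrakk>
      \<Longrightarrow> \<delta> (f (length w)) a = f (length (apply_subst \<phi> w) + a)"
    and "1 \<le> n"
  shows "foldl \<delta> (f 0) (normal_rep (U_seq \<phi>) n) = f n"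
proof -
  obtain k where k: "n < U_seq \<phi> (Suc k)"
    "normal_rep (U_seq \<phi>) n = greedy_digits (U_seq \<phi>) k n"
    using normal_rep_eq[OF \<open>1 \<le> n\<close>] .
  have "foldl \<delta> (f (length ([] :: nat list))) (greedy_digits (U_seq \<phi>) k n)
      = f (length ((apply_subst \<phi> ^^ Suc k) []) + n)"
  proof (rule foldl_greedy_digits[where \<delta> = \<delta> and f = f and w = "[]" and i = 0])
    show "n < L (Suc k) 0"
      using k(1) by (simp only: U_seq_eq)
    show "is_prefix ([] @ orb 0)"
      by (simp add: is_prefix_def orb_0 u_0)
  qed (rule step)
  then show ?thesis
    using k(2) by (simp only: apply_subst_pow_Nil list.size add_0)
qed

section \<open>Cuts of the infinite word and their images\<close>

lemma sum_parikh_mult: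
  assumes "set w \<subseteq> {..<N}"
  shows "(\<Sum>i<N. parikh w i * g i) = sum_list (map g w)"
  using assms
proof (induction w)
  case Nil
  then show ?case by (simp add: parikh_def)
next
  case (Cons x w)
  have "(\<Sum>i<N. parikh (x # w) i * g i) = (\<Sum>i<N. (if x = i then g i else 0) + parikh w i * g i)"
    by (intro sum.cong) (auto simp: parikh_def algebra_simps)
  also have "\<dots> = g x + sum_list (map g w)"
    using Cons by (simp add: sum.distrib)
  finally show ?case by simp
qed

definition P :: "nat \<Rightarrow> nat \<Rightarrow> int" where
  "P n = parikh (prefix n u)"

text \<open>
  The substitution maps the cut \<open>n\<close> of \<open>u\<close> to the cut \<open>img n\<close>, where the block \<open>\<phi> (u n)\<close> begins.
\<close>
definition img :: "nat \<Rightarrow> nat" where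
  "img n = length (apply_subst \<phi> (prefix n u))"

lemma set_prefix: "set (prefix n u) \<subseteq> {..<N}"
  using letter by auto

lemma img_0 [simp]: "img 0 = 0"
  by (simp add: img_def)

lemma img_Suc: "img (Suc n) = img n + length (\<phi> (u n))"
  by (simp add: img_def)

lemma le_img: "n \<le> img n"
proof (induction n)
  case (Suc n)
  then show ?case
    unfolding img_Suc using subst_nonempty[OF letter[of n]] by linarith
qed simp

lemma prefix_img_Suc:
  "prefix (img n + length (\<phi> (u n))) u = apply_subst \<phi> (prefix n u) @ \<phi> (u n)"
proof -
  have "is_prefix (apply_subst \<phi> (prefix (Suc n) u))"
    by (intro is_prefix_subst is_prefix_prefix)
  then show ?thesis
    by (simp add: is_prefix_def img_def)
qed

lemma prefix_img_add:
  assumes "r \<le> length (\<phi> (u n))"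
  shows "prefix (img n + r) u = apply_subst \<phi> (prefix n u) @ take r (\<phi> (u n))"
proof -
  have "prefix (img n + r) u = take (img n + r) (prefix (img n + length (\<phi> (u n))) u)"
    using assms by (simp add: min_def)
  also have "\<dots> = apply_subst \<phi> (prefix n u) @ take r (\<phi> (u n))"
    unfolding prefix_img_Suc by (simp add: img_def)
  finally show ?thesis .
qed

lemma u_img_add:
  assumes "r < length (\<phi> (u n))"
  shows "u (img n + r) = \<phi> (u n) ! r"
proof -
  have "u (img n + r) = prefix (img n + length (\<phi> (u n))) u ! (img n + r)"
    using assms by simp
  also have "\<dots> = \<phi> (u n) ! r"
    unfolding prefix_img_Suc by (simp add: img_def nth_append)
  finally show ?thesis .
qed

lemma block_decomposition:
  obtains j r where "i = img j + r" "r < length (\<phi> (u j))"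
proof -
  have "\<exists>j r. i = img j + r \<and> r < length (\<phi> (u j))"
  proof (induction i)
    case 0
    show ?case
      using subst_nonempty[OF letter[of 0]] by (intro exI[of _ 0]) simp
  next
    case (Suc i)
    then obtain j r where j: "i = img j + r" "r < length (\<phi> (u j))"
      by blast
    show ?case
    proof (cases "Suc r < length (\<phi> (u j))")
      case True
      then show ?thesis
        using j by (intro exI[of _ j] exI[of _ "Suc r"]) simp
    next
      case False
      then have "Suc i = img (Suc j) + 0"
        using j by (simp add: img_Suc)
      then show ?thesis
        using subst_nonempty[OF letter] by blast
    qed
  qed
  then show ?thesis using that by blast
qed

definition tot :: "(nat \<Rightarrow> int) \<Rightarrow> int" where
  "tot d = (\<Sum>l<N. d l)"

lemma tot_P: "tot (P n) = int n"
  using sum_parikh_mult[OF set_prefix, of n "\<lambda>_. 1"]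
  by (simp add: tot_def P_def sum_list_triv)

lemma img_eq_sum: "int (img n) = (\<Sum>i<N. P n i * int (length (\<phi> i)))"
proof -
  have "int (length (apply_subst \<phi> w)) = sum_list (map (\<lambda>i. int (length (\<phi> i))) w)" for w
    by (induction w) (auto simp: apply_subst_def)
  then show ?thesis
    unfolding P_def sum_parikh_mult[OF set_prefix] img_def .
qed

lemma parikh_image:
  "parikh (apply_subst \<phi> (prefix n u)) l = (\<Sum>i<N. P n i * parikh (\<phi> i) l)"
proof -
  have "parikh (apply_subst \<phi> w) l = sum_list (map (\<lambda>i. parikh (\<phi> i) l) w)" for w
    by (induction w) (auto simp: apply_subst_def parikh_def)
  then show ?thesis
    unfolding P_def sum_parikh_mult[OF set_prefix] .
qed

lemma P_img_add:
  assumes "r \<le> length (\<phi> (u n))"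
  shows "P (img n + r) l = (\<Sum>i<N. P n i * parikh (\<phi> i) l) + parikh (take r (\<phi> (u n))) l"
  unfolding P_def prefix_img_add[OF assms] parikh_append parikh_image[unfolded P_def] ..

lemma P_add: "P (i + g) l = P i l + parikh (subsequence u i (i + g)) l"
  unfolding P_def subsequence_append parikh_append ..

lemma P_Suc: "P (Suc n) l = P n l + (if u n = l then 1 else 0)"
  by (simp add: P_def parikh_append) (simp add: parikh_def)

lemma P_add_bounds: "P i l \<le> P (i + g) l" "P (i + g) l \<le> P i l + int g"
  by (induction g) (auto simp: P_Suc)

lemma P_outside: "N \<le> l \<Longrightarrow> P n l = 0"
proof -
  assume "N \<le> l"
  then have "l \<notin> set (prefix n u)"
    using set_prefix[of n] by (meson lessThan_iff not_le subsetD)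
  then show "P n l = 0"
    unfolding P_def parikh_def by (subst count_notin) simp_all
qed

text \<open>
  Following last letters, the letter at \<open>i\<close> reaches an orbit letter whose image contains a zero. Each
  step moves to a position that is not smaller, as \<open>img\<close> does not decrease positions.
\<close>
lemma zero_recurrent: "\<exists>j\<ge>i. u j = 0"
proof -
  have ind: "\<exists>j\<ge>i. u j = 0" if "0 < t (l + d)" "orb l = [u i]" for l d i
    using that
  proof (induction d arbitrary: l i)
    case 0
    have "\<phi> (u i) = replicate (t l) 0 @ orb (Suc l)"
      using orb_subst[of l] 0 by simp
    then have "u (img i + 0) = 0"
      using 0(1) by (subst u_img_add) (auto simp: nth_append)
    then show ?case
      using le_img[of i] by auto
  next
    case (Suc d)
    have eq: "\<phi> (u i) = replicate (t l) 0 @ orb (Suc l)"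
      using orb_subst[of l] Suc.prems by simp
    show ?case
    proof (cases "t l = 0")
      case True
      have "orb (Suc l) \<noteq> []"
        unfolding orb_alive using Suc.prems(1) by (intro exI[of _ "l + Suc d"]) simp
      then obtain x where x: "orb (Suc l) = [x]"
        using orb_length[of "Suc l"] by (cases "orb (Suc l)") auto
      then have "u (img i + 0) = x"
        using True eq by (subst u_img_add) auto
      then obtain j where "j \<ge> img i" "u j = 0"
        using Suc.IH[of "Suc l" "img i"] Suc.prems(1) x by auto
      then show ?thesis
        using le_img[of i] by (intro exI[of _ j]) simp
    next
      case False
      then have "u (img i + 0) = 0"
        using eq by (subst u_img_add) (auto simp: nth_append)
      then show ?thesis
        using le_img[of i] by auto
    qed
  qed
  have o: "orb (u i) = [u i]"
    by (simp add: letter orb_letter)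
  then obtain k where "k \<ge> u i" "0 < t k"
    using orb_alive[of "u i"] by auto
  then show ?thesis
    using ind[of "u i" "k - u i" i] o by simp
qed

lemma zeros_unbounded: "\<exists>n. int C \<le> P n 0"
proof (induction C)
  case 0
  show ?case
    by (intro exI[of _ 0]) (simp add: P_def parikh_def)
next
  case (Suc C)
  then obtain n where n: "int C \<le> P n 0" by blast
  obtain j where j: "j \<ge> n" "u j = 0"
    using zero_recurrent by blast
  have "P n 0 \<le> P j 0"
    using P_add_bounds(1)[of n 0 "j - n"] j by simp
  then show ?case
    using n j by (intro exI[of _ "Suc j"]) (simp add: P_Suc)
qed

text \<open>
  Non-erasing alone gives no more than one letter per letter; the gain comes from the zeros, whose
  images have length at least two.
\<close>
lemma img_growth: "int (img n) + int g + (P (n + g) 0 - P n 0) \<le> int (img (n + g))"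
proof (induction g)
  case (Suc g)
  have "1 + (if u (n + g) = 0 then 1 else 0) \<le> int (length (\<phi> (u (n + g))))"
    using subst_zero_length subst_nonempty[OF letter[of "n + g"]]
    by (cases "u (n + g) = 0") (simp_all add: Suc_le_eq)
  then show ?case
    using Suc by (simp add: img_Suc P_Suc split: if_splits)
qed simp

text \<open>
  For \<open>j = i + n\<close> this is the relative Parikh vector of the factor between the cuts \<open>i\<close> and \<open>j\<close>. Both
  longer and shorter pairs occur, even with \<open>j < i\<close>: two cuts in one block may come in either order
  after choosing offsets, and keeping both orders makes the transition independent of whether the
  blocks coincide.
\<close>
definition rel :: "nat \<Rightarrow> nat \<Rightarrow> nat \<Rightarrow> nat \<Rightarrow> int" where
  "rel n i j = (\<lambda>l. P j l - P i l - P n l)"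

lemma tot_rel: "tot (rel n i j) = int j - int i - int n"
proof -
  have "tot (rel n i j) = tot (P j) - tot (P i) - tot (P n)"
    by (simp add: tot_def rel_def sum_subtractf)
  then show ?thesis
    by (simp add: tot_P)
qed

definition state :: "nat \<Rightarrow> nat \<Rightarrow> ((nat \<Rightarrow> int) \<times> nat \<times> nat) set" where
  "state K n = {(rel n i j, u i, u j) | i j. \<bar>tot (rel n i j)\<bar> \<le> int K}"

text \<open>
  The vector over the cuts at offsets \<open>r\<close> and \<open>s\<close> in the images of the end letters \<open>e\<close> and \<open>f\<close>,
  expressed by the vector \<open>d\<close> before substitution.
\<close>
definition rel_image :: "nat \<Rightarrow> (nat \<Rightarrow> int) \<Rightarrow> nat \<Rightarrow> nat \<Rightarrow> nat \<Rightarrow> nat \<Rightarrow> nat \<Rightarrow> int" where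
  "rel_image a d e r f s = (\<lambda>l. (\<Sum>i<N. d i * parikh (\<phi> i) l) + parikh (take s (\<phi> f)) l
     - parikh (take r (\<phi> e)) l - parikh (replicate a 0) l)"

definition state_step ::
  "nat \<Rightarrow> nat \<Rightarrow> ((nat \<Rightarrow> int) \<times> nat \<times> nat) set \<Rightarrow> ((nat \<Rightarrow> int) \<times> nat \<times> nat) set" where
  "state_step K a X = {(rel_image a d e r f s, \<phi> e ! r, \<phi> f ! s) | d e r f s.
     (d, e, f) \<in> X \<and> r < length (\<phi> e) \<and> s < length (\<phi> f) \<and>
     \<bar>tot (rel_image a d e r f s)\<bar> \<le> int K}"

lemma rel_img:
  assumes r: "r < length (\<phi> (u i))" and s: "s < length (\<phi> (u j))"
    and a: "is_prefix (apply_subst \<phi> (prefix n u) @ replicate a 0)"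
  shows "rel (img n + a) (img i + r) (img j + s) = rel_image a (rel n i j) (u i) r (u j) s"
proof
  fix l
  have "P (img n + a) = parikh (apply_subst \<phi> (prefix n u) @ replicate a 0)"
    using a by (simp add: P_def is_prefix_def img_def)
  then have "P (img n + a) l = (\<Sum>i<N. P n i * parikh (\<phi> i) l) + parikh (replicate a 0) l"
    by (simp add: parikh_append parikh_image)
  then show "rel (img n + a) (img i + r) (img j + s) l = rel_image a (rel n i j) (u i) r (u j) s l"
    using r s by (simp add: rel_def rel_image_def P_img_add left_diff_distrib sum_subtractf)
qed

lemma rel_parikh_set_eq_state:
  "rel_parikh_set u n = {d. \<exists>e f. (d, e, f) \<in> state K n \<and> tot d = 0}"
proof -
  have eq: "rel_parikh u (subsequence u i (i + n)) = rel n i (i + n)" for i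
    by (simp add: fun_eq_iff rel_parikh_def rel_def P_add) (simp add: P_def)
  have "(\<exists>i. w = subsequence u i (i + length w)) \<and> length w = n \<longleftrightarrow>
      (\<exists>i. w = subsequence u i (i + n))" for w
    by auto
  then have "rel_parikh_set u n = {rel n i (i + n) | i. True}"
    unfolding rel_parikh_set_def is_factor_def eq[symmetric] by auto
  also have "\<dots> = {d. \<exists>i j. d = rel n i j \<and> tot d = 0}"
  proof -
    have "tot (rel n i j) = 0 \<longleftrightarrow> j = i + n" for i j
      by (simp add: tot_rel) linarith
    then show ?thesis
      by auto
  qed
  also have "\<dots> = {d. \<exists>e f. (d, e, f) \<in> state K n \<and> tot d = 0}"
    unfolding state_def by (auto; metis abs_zero of_nat_0_le_iff)
  finally show ?thesis .
qed

end

section \<open>Balance and expansion\<close>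

locale balanced_parry_word = parry_word +
  fixes c :: nat
  assumes balance: "balanced N c u"
begin

lemma P_balanced:
  assumes "l < N"
  shows "\<bar>P (i + g) l - P i l - P g l\<bar> \<le> int c"
proof -
  have "is_factor (subsequence u i (i + g)) u" "is_factor (prefix g u) u"
    by (auto simp: is_factor_def intro: exI[of _ i] exI[of _ 0])
  then have "\<bar>parikh (subsequence u i (i + g)) l - parikh (prefix g u) l\<bar> \<le> int c"
    using balance assms unfolding balanced_def parikh_def by simp
  then show ?thesis
    by (simp add: P_add) (simp add: P_def)
qed

text \<open>
  A coordinate deviates by at most \<open>c\<close>, and each letter has an image of length at most \<open>t 0 + 1\<close>.
\<close>
definition defect :: int where
  "defect = int N * (int c * int (t 0 + 1))"

lemma img_almost_additive: "\<bar>int (img (i + g)) - int (img i) - int (img g)\<bar> \<le> defect"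
proof -
  have "int (img (i + g)) - int (img i) - int (img g)
      = (\<Sum>l<N. (P (i + g) l - P i l - P g l) * int (length (\<phi> l)))"
    by (simp add: img_eq_sum left_diff_distrib sum_subtractf)
  also have "\<bar>\<dots>\<bar> \<le> (\<Sum>l<N. int c * int (t 0 + 1))"
  proof (rule order_trans[OF sum_abs sum_mono])
    fix l assume "l \<in> {..<N}"
    then show "\<bar>(P (i + g) l - P i l - P g l) * int (length (\<phi> l))\<bar> \<le> int c * int (t 0 + 1)"
      unfolding abs_mult using P_balanced[of l i g] subst_length_le[of l]
      by (intro mult_mono) auto
  qed
  also have "\<dots> = defect"
    by (simp add: defect_def)
  finally show ?thesis .
qed

text \<open>
  By balance every sufficiently long factor contains arbitrarily many zeros, because long prefixes
  do; each zero contributes an extra letter to the image.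
\<close>
lemma img_expanding: "\<exists>K. \<forall>n g. K \<le> g \<longrightarrow> int (img n) + int g + int C \<le> int (img (n + g))"
proof -
  obtain K where K: "int (C + c) \<le> P K 0"
    using zeros_unbounded by blast
  have "int (img n) + int g + int C \<le> int (img (n + g))" if "K \<le> g" for n g
  proof -
    have "P K 0 \<le> P g 0"
      using P_add_bounds(1)[of K 0 "g - K"] that by simp
    moreover have "\<bar>P (n + g) 0 - P n 0 - P g 0\<bar> \<le> int c"
      using two_letters by (intro P_balanced) simp
    ultimately show ?thesis
      using K img_growth[of n g] by simp
  qed
  then show ?thesis by blast
qed

text \<open>
  The gain needed in \<open>window_pullback\<close>: the two offsets and the digit contribute at most \<open>t 0 + 1\<close> each,
  and almost additivity of \<open>img\<close> is used at most twice.
\<close>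
definition slack :: nat where
  "slack = nat (3 * int (t 0 + 1) + 2 * defect + 1)"

definition window :: nat where
  "window = (SOME K. \<forall>n g. K \<le> g \<longrightarrow> int (img n) + int g + int slack \<le> int (img (n + g)))"

lemma window:
  assumes "window \<le> g"
  shows "int (img n) + int g + 3 * int (t 0 + 1) + 2 * defect < int (img (n + g))"
proof -
  have "0 \<le> defect"
    by (simp add: defect_def)
  moreover have "int (img n) + int g + int slack \<le> int (img (n + g))"
    using someI_ex[OF img_expanding[of slack]] assms unfolding window_def by blast
  ultimately show ?thesis
    unfolding slack_def by linarith
qed

text \<open>
  If the cuts \<open>i\<close> and \<open>j\<close> had a distance too far from \<open>n\<close>, the substitution would add at least
  \<open>slack\<close> to the discrepancy, which the offsets, the digit and the defect cannot compensate. For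
  \<open>j < i\<close> the discrepancy is the sum \<open>(i - j) + n\<close>, and the same growth applies to a prefix of this
  length.
\<close>
lemma window_pullback:
  assumes "\<bar>int (img j + s) - int (img i + r) - int (img n + a)\<bar> \<le> int window"
    and "r \<le> t 0 + 1" "s \<le> t 0 + 1" "a \<le> t 0 + 1"
  shows "\<bar>int j - int i - int n\<bar> \<le> int window"
proof (rule ccontr)
  assume neg: "\<not> ?thesis"
  have near: "\<bar>int (img j) - int (img i) - int (img n)\<bar> \<le> int window + 3 * int (t 0 + 1)"
  proof -
    have "int r \<le> int (t 0 + 1)" "int s \<le> int (t 0 + 1)" "int a \<le> int (t 0 + 1)"
      using assms(2-4) by simp_all
    moreover have "0 \<le> int r" "0 \<le> int s" "0 \<le> int a"
      by simp_all
    ultimately show ?thesis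
      using assms(1) unfolding of_nat_add of_nat_1 abs_le_iff
      by auto
  qed
  have nonneg: "0 \<le> defect"
    by (simp add: defect_def)
  show False
  proof (cases "i \<le> j")
    case True
    define g where "g = j - i"
    have j: "j = i + g"
      using True by (simp add: g_def)
    have far: "int window < \<bar>int g - int n\<bar>"
      using neg by (simp add: j)
    have "\<bar>int (img g) - int (img n)\<bar> \<le> int window + 3 * int (t 0 + 1) + defect"
      using near img_almost_additive[of i g] unfolding j by linarith
    moreover have "int window + 3 * int (t 0 + 1) + defect < \<bar>int (img g) - int (img n)\<bar>"
    proof (cases "n \<le> g")
      case True
      moreover from this have "window \<le> g - n"
        using far by linarith
      ultimately show ?thesis
        using far window[of "g - n" n] nonneg by auto
    next
      case False
      moreover from this have "window \<le> n - g"
        using far by linarith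
      ultimately show ?thesis
        using far window[of "n - g" g] nonneg by auto
    qed
    ultimately show False by linarith
  next
    case False
    define g where "g = i - j"
    have i: "i = j + g"
      using False by (simp add: g_def)
    have "int (img (g + n)) \<le> int window + 3 * int (t 0 + 1) + 2 * defect"
      using near img_almost_additive[of j g] img_almost_additive[of g n] unfolding i by linarith
    moreover have "int window < int (g + n)"
      using neg by (simp add: i)
    ultimately show False
      using window[of "g + n" 0] by simp
  qed
qed

section \<open>Finitely many states\<close>

text \<open>
  Every pair of cuts close to the distance \<open>img n + a\<close> arises from a pair close to the distance \<open>n\<close>;
  conversely, pairs at too large a distance after substitution are discarded by the bound in
  \<open>state_step\<close>.
\<close>
lemma state_img:
  assumes a: "is_prefix (apply_subst \<phi> (prefix n u) @ replicate a 0)" "a \<le> t 0"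
  shows "state window (img n + a) = state_step window a (state window n)"
proof (intro equalityI subsetI)
  fix x assume "x \<in> state window (img n + a)"
  then obtain i' j' where x: "x = (rel (img n + a) i' j', u i', u j')"
    and near: "\<bar>tot (rel (img n + a) i' j')\<bar> \<le> int window"
    by (auto simp: state_def)
  obtain i r where i: "i' = img i + r" "r < length (\<phi> (u i))"
    by (rule block_decomposition)
  obtain j s where j: "j' = img j + s" "s < length (\<phi> (u j))"
    by (rule block_decomposition)
  have "\<bar>int j - int i - int n\<bar> \<le> int window"
  proof (rule window_pullback)
    show "\<bar>int (img j + s) - int (img i + r) - int (img n + a)\<bar> \<le> int window"
      using near unfolding tot_rel i j .
  qed (use i j a subst_length_le[OF letter[of i]] subst_length_le[OF letter[of j]] in simp_all)
  then have "(rel n i j, u i, u j) \<in> state window n"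
    unfolding state_def tot_rel[symmetric] by blast
  then show "x \<in> state_step window a (state window n)"
    using near i(2) j(2) unfolding x i(1) j(1) state_step_def rel_img[OF i(2) j(2) a(1)]
      u_img_add[OF i(2)] u_img_add[OF j(2)] by blast
next
  fix x assume "x \<in> state_step window a (state window n)"
  then obtain i r j s where rs: "r < length (\<phi> (u i))" "s < length (\<phi> (u j))"
    and x: "x = (rel_image a (rel n i j) (u i) r (u j) s, \<phi> (u i) ! r, \<phi> (u j) ! s)"
    and near: "\<bar>tot (rel_image a (rel n i j) (u i) r (u j) s)\<bar> \<le> int window"
    unfolding state_step_def state_def by blast
  show "x \<in> state window (img n + a)"
    using near unfolding x rel_img[OF rs a(1), symmetric] u_img_add[OF rs(1), symmetric]
      u_img_add[OF rs(2), symmetric] state_def by blast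
qed

text \<open>
  Balance compares the factor with the prefix of the same length, and passing from that prefix to the
  one of length \<open>n\<close> changes each coordinate by at most \<open>K\<close>. For \<open>j < i\<close> the bound on the coordinate sum
  forces both lengths to be at most \<open>K\<close>.
\<close>
lemma rel_bounded:
  assumes "\<bar>tot (rel n i j)\<bar> \<le> int K" "l < N"
  shows "\<bar>rel n i j l\<bar> \<le> int (K + c)"
proof (cases "i \<le> j")
  case True
  define g where "g = j - i"
  have j: "j = i + g"
    using True by (simp add: g_def)
  have "\<bar>int g - int n\<bar> \<le> int K"
    using assms(1) by (simp add: tot_rel j)
  moreover have "\<bar>P g l - P n l\<bar> \<le> \<bar>int g - int n\<bar>"
    using P_add_bounds[where i = g and l = l and g = "n - g"]
      P_add_bounds[where i = n and l = l and g = "g - n"]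
    by (cases "g \<le> n") auto
  ultimately show ?thesis
    using P_balanced[OF assms(2), of i g] unfolding rel_def j by linarith
next
  case False
  define g where "g = i - j"
  have i: "i = j + g"
    using False by (simp add: g_def)
  have "int g + int n \<le> int K"
    using assms(1) by (simp add: tot_rel i)
  moreover have "P 0 l = 0"
    by (simp add: P_def parikh_def)
  ultimately show ?thesis
    using P_add_bounds[where i = j and l = l and g = g]
      P_add_bounds[where i = 0 and l = l and g = n]
    unfolding rel_def i by simp
qed

lemma finite_range_state: "finite (range (state K))"
proof -
  define V :: "(nat \<Rightarrow> int) set" where
    "V = {d. \<forall>l. (l \<in> {..<N} \<longrightarrow> d l \<in> {- int (K + c)..int (K + c)}) \<and> (l \<notin> {..<N} \<longrightarrow> d l = 0)}"
  have "finite V"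
    unfolding V_def by (intro finite_set_of_finite_funs) auto
  moreover have "rel n i j \<in> V" if "\<bar>tot (rel n i j)\<bar> \<le> int K" for n i j
  proof -
    have "rel n i j l \<in> {- int (K + c)..int (K + c)}" if "l < N" for l
      using rel_bounded[OF \<open>\<bar>tot (rel n i j)\<bar> \<le> int K\<close> that] by (auto simp: abs_le_iff)
    then show ?thesis
      by (simp add: V_def) (simp add: rel_def P_outside)
  qed
  then have "range (state K) \<subseteq> Pow (V \<times> {..<N} \<times> {..<N})"
    using letter by (auto simp: state_def)
  ultimately show ?thesis
    by (meson finite_Pow_iff finite_SigmaI finite_lessThan finite_subset)
qed

text \<open>
  States are named by natural numbers that realise them, so that \<open>state window\<close> itself decodes. The
  value 0 serves sets that are not states; these arise only from digits that cannot follow.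
\<close>
definition code :: "((nat \<Rightarrow> int) \<times> nat \<times> nat) set \<Rightarrow> nat" where
  "code X = (if X \<in> range (state window) then LEAST n. state window n = X else 0)"

lemma state_code [simp]: "state window (code (state window n)) = state window n"
  using LeastI[of "\<lambda>m. state window m = state window n" n] by (simp add: code_def)

text \<open>
  It suffices to preserve relative Parikh sets: the automaton ends in a number \<open>q\<close> with the same
  relative Parikh set as \<open>n\<close>, so any function of that set can be read off from \<open>q\<close>.
\<close>
lemma automaton:
  "\<exists>(Q :: nat set) q0 (\<delta> :: nat \<Rightarrow> nat \<Rightarrow> nat).
    finite Q \<and> q0 \<in> Q \<and> (\<forall>q\<in>Q. \<forall>a\<in>{0..t 0}. \<delta> q a \<in> Q) \<and>
    (\<forall>n\<ge>1. rel_parikh_set u (foldl \<delta> q0 (normal_rep (U_seq \<phi>) n)) = rel_parikh_set u n)"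
proof (intro exI conjI)
  define Q where "Q = insert 0 (code ` range (state window))"
  define \<delta> where "\<delta> q a = code (state_step window a (state window q))" for q a
  show "finite Q"
    using finite_range_state by (simp add: Q_def)
  show "code (state window 0) \<in> Q"
    by (simp add: Q_def)
  have "code X \<in> Q" for X
    by (cases "X \<in> range (state window)") (auto simp: Q_def code_def)
  then show "\<forall>q\<in>Q. \<forall>a\<in>{0..t 0}. \<delta> q a \<in> Q"
    by (simp add: \<delta>_def)
  define f where "f n = code (state window n)" for n
  have "\<delta> (f (length w)) a = f (length (apply_subst \<phi> w) + a)"
    if "is_prefix w" "a \<le> t 0" "is_prefix (apply_subst \<phi> w @ replicate a 0)" for w a
  proof -
    have w: "w = prefix (length w) u"
      using that(1) by (simp add: is_prefix_def)
    then have "length (apply_subst \<phi> w) = img (length w)"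
      by (simp add: img_def)
    then show ?thesis
      using state_img[of "length w" a] that w by (simp add: \<delta>_def f_def)
  qed
  then have run: "foldl \<delta> (f 0) (normal_rep (U_seq \<phi>) n) = f n" if "1 \<le> n" for n
    using that by (rule foldl_normal_rep)
  have "rel_parikh_set u (f n) = rel_parikh_set u n" for n
    by (simp add: rel_parikh_set_eq_state[where K = window] f_def)
  then show "\<forall>n\<ge>1. rel_parikh_set u (foldl \<delta> (code (state window 0)) (normal_rep (U_seq \<phi>) n))
      = rel_parikh_set u n"
    using run by (simp add: f_def)
qed

end

section \<open>Simple and non-simple Parry words\<close>

lemma parry_word_simple:
  assumes params: "simple_parry_params m \<alpha>" and u: "is_fixed_point m (simple_subst m \<alpha>) u"
  shows "parry_word m (simple_subst m \<alpha>) u (\<lambda>i. if i < m then [i] else [])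
    (map \<alpha> [0..<m] \<frown> [0]\<^sup>\<omega>)"
proof -
  have t: "(map \<alpha> [0..<m] \<frown> [0]\<^sup>\<omega>) i = (if i < m then \<alpha> i else 0)" for i
    by (simp add: conc_def)
  show ?thesis
  proof
    fix i
    show "(if i < m then [i] else []) \<noteq> [] \<longleftrightarrow> (\<exists>k\<ge>i. 0 < (map \<alpha> [0..<m] \<frown> [0]\<^sup>\<omega>) k)"
      using params unfolding t by (auto simp: simple_parry_params_def intro!: exI[of _ "m - 1"])
  qed (use params u in \<open>auto simp: simple_parry_params_def simple_subst_def t\<close>)
qed

lemma parry_word_nonsimple:
  assumes params: "nonsimple_parry_params m p \<alpha>"
    and u: "is_fixed_point (m + p) (nonsimple_subst m p \<alpha>) u"
  shows "parry_word (m + p) (nonsimple_subst m p \<alpha>) u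
    (\<lambda>i. [if i < m then i else m + (i - m) mod p]) (map \<alpha> [0..<m] \<frown> (map \<alpha> [m..<m + p])\<^sup>\<omega>)"
proof -
  have p: "0 < p"
    using params by (simp add: nonsimple_parry_params_def)
  have t: "(map \<alpha> [0..<m] \<frown> (map \<alpha> [m..<m + p])\<^sup>\<omega>) i
      = \<alpha> (if i < m then i else m + (i - m) mod p)" for i
    using p by (simp add: conc_def)
  show ?thesis
  proof
    fix i
    obtain q where q: "q \<in> {m..<m + p}" "0 < \<alpha> q"
      using params by (auto simp: nonsimple_parry_params_def Suc_le_eq)
    have "q - m < p"
      using q(1) by auto
    then have "(q + p * i - m) mod p = q - m"
      using q(1) by (simp flip: add_diff_assoc2)
    then have "0 < \<alpha> (if q + p * i < m then q + p * i else m + (q + p * i - m) mod p)"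
      using q by simp
    moreover have "i \<le> q + p * i"
      using p by (simp add: trans_le_add2)
    ultimately show "[if i < m then i else m + (i - m) mod p] \<noteq> [] \<longleftrightarrow>
        (\<exists>k\<ge>i. 0 < (map \<alpha> [0..<m] \<frown> (map \<alpha> [m..<m + p])\<^sup>\<omega>) k)"
      unfolding t by blast
    show "apply_subst (nonsimple_subst m p \<alpha>) [if i < m then i else m + (i - m) mod p]
      = replicate ((map \<alpha> [0..<m] \<frown> (map \<alpha> [m..<m + p])\<^sup>\<omega>) i) 0
        @ [if Suc i < m then Suc i else m + (Suc i - m) mod p]"
      unfolding t using p
      by (auto simp: nonsimple_subst_def Suc_diff_le mod_Suc not_less_eq le_Suc_eq intro!: Suc_lessI)
  qed (use params u in \<open>auto simp: nonsimple_parry_params_def t\<close>)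
qed

lemma parry_word_exists:
  assumes "parry_substitution N \<alpha> \<phi>" "is_fixed_point N \<phi> u"
  obtains orb t where "parry_word N \<phi> u orb t" "t 0 = \<alpha> 0"
proof -
  consider m where "simple_parry_params m \<alpha>" "N = m" "\<phi> = simple_subst m \<alpha>"
    | m p where "nonsimple_parry_params m p \<alpha>" "N = m + p" "\<phi> = nonsimple_subst m p \<alpha>"
    using assms(1) unfolding parry_substitution_def by blast
  then show ?thesis
  proof cases
    case 1
    show ?thesis
    proof (rule that)
      show "parry_word N \<phi> u (\<lambda>i. if i < m then [i] else []) (map \<alpha> [0..<m] \<frown> [0]\<^sup>\<omega>)"
        using parry_word_simple[OF 1(1)] assms(2) 1 by simp
    qed (use 1 in \<open>simp add: simple_parry_params_def\<close>)
  next
    case 2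
    show ?thesis
    proof (rule that)
      show "parry_word N \<phi> u (\<lambda>i. [if i < m then i else m + (i - m) mod p])
          (map \<alpha> [0..<m] \<frown> (map \<alpha> [m..<m + p])\<^sup>\<omega>)"
        using parry_word_nonsimple[OF 2(1)] assms(2) 2 by simp
    qed (use 2 in \<open>simp add: nonsimple_parry_params_def\<close>)
  qed
qed

theorem mainTheorem4:
  fixes N c :: nat and \<alpha> :: "nat \<Rightarrow> nat" and \<phi> :: substitution and u :: "nat word"
  assumes "parry_substitution N \<alpha> \<phi>"
    and "is_fixed_point N \<phi> u"
    and "c > 0"
    and "balanced N c u"
  shows "\<exists>(Q :: nat set) q0 (\<delta> :: nat \<Rightarrow> nat \<Rightarrow> nat).
    finite Q \<and> q0 \<in> Q \<and> (\<forall>q\<in>Q. \<forall>a\<in>{0..\<alpha> 0}. \<delta> q a \<in> Q) \<and>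
    (\<forall>F \<in> {1::nat..} \<rightarrow> {1::nat..}.
       (\<exists>G \<in> rel_parikh_set u ` {1..} \<rightarrow> {1..}. \<forall>n\<ge>1. F n = G (rel_parikh_set u n)) \<longrightarrow>
       (\<exists>\<tau> \<in> Q \<rightarrow> {1..}. \<forall>n\<ge>1. F n = \<tau> (foldl \<delta> q0 (normal_rep (U_seq \<phi>) n))))"
proof -
  obtain orb t where "parry_word N \<phi> u orb t" and t: "t 0 = \<alpha> 0"
    using parry_word_exists[OF assms(1,2)] .
  then interpret balanced_parry_word N \<phi> u orb t c
    using assms(4) by (simp add: balanced_parry_word_def balanced_parry_word_axioms_def)
  obtain Q q0 \<delta> where Q: "finite Q" "q0 \<in> Q" "\<forall>q\<in>Q. \<forall>a\<in>{0..\<alpha> 0}. \<delta> q a \<in> Q"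
    and run: "\<And>n. 1 \<le> n \<Longrightarrow>
      rel_parikh_set u (foldl \<delta> q0 (normal_rep (U_seq \<phi>) n)) = rel_parikh_set u n"
    using automaton unfolding t by blast
  have "\<exists>\<tau> \<in> Q \<rightarrow> {1..}. \<forall>n\<ge>1. F n = \<tau> (foldl \<delta> q0 (normal_rep (U_seq \<phi>) n))"
    if G: "G \<in> rel_parikh_set u ` {1..} \<rightarrow> {1..}" "\<forall>n\<ge>1. F n = G (rel_parikh_set u n)"
    for F G :: "_ \<Rightarrow> nat"
    \<comment> \<open>Some states may realise the relative Parikh set of no positive number, where \<open>G\<close> is unconstrained;
      the output there is set to 1.\<close>
  proof (intro bexI[where x = "\<lambda>q. if rel_parikh_set u q \<in> rel_parikh_set u ` {1..}
      then G (rel_parikh_set u q) else 1"] allI impI)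
    fix n :: nat assume "1 \<le> n"
    then show "F n = (if rel_parikh_set u (foldl \<delta> q0 (normal_rep (U_seq \<phi>) n))
          \<in> rel_parikh_set u ` {1..}
        then G (rel_parikh_set u (foldl \<delta> q0 (normal_rep (U_seq \<phi>) n))) else 1)"
      using run G(2) by simp
  qed (use G(1) in \<open>auto simp: Pi_iff\<close>)
  then show ?thesis
    using Q by (intro exI[of _ Q] exI[of _ q0] exI[of _ \<delta>]) blast
qed

end
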